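(* Let $(M,f)$ be an isotropic surface of $\mathbb S^3_1(1)$ equipped with a non-constant Gauss map $\nu(w)$. If the surface $f(M)$ is minimal, then $(M,\nu)$ has the same isotropic parameters and is also minimal, with $$\nu_u(w)=\frac{-a(w)}{F(w)}f_v(w),\qquad \nu_v(w)=\frac{-c(w)}{F(w)}f_u(w).$$ Moreover, the Gauss curvatures $K(f)$ of $f(M)$ and $K(\nu)$ of $\nu(M)$ are related by the equation $$F^2K(f)+ac\,K(\nu)=0.$$ Hence, $(M,f)$ is flat if and only if $(M,\nu)$ is flat.
   Context: $\mathbb R^4_1$ is $\mathbb R^4$ with $\langle p,q\rangle=-p^1q^1+p^2q^2+p^3q^3+p^4q^4$, oriented by its canonical basis and time-oriented by the first basis vector; $\mathbb S^3_1(1)=\{p:\langle p,p\rangle=1\}$. $M\subset\mathbb C\cong\mathbb R^2$ is open, connected and simply connected, with points $w=(u,v)=u+iv$. An isotropic surface $(M,f)$ of $\mathbb S^3_1(1)$ is a timelike surface in null coordinates: $f:M\to\mathbb R^4_1$ is smooth, a homeomorphism onto its image, $\langle f,f\rangle=1$, $f_u,f_v$ are linearly independent, and the induced metric is $2F\,du\,dv$, i.e. $\langle f_u,f_u\rangle=\langle f_v,f_v\rangle=0$, $F=\langle f_u,f_v\rangle\ne0$; $f_u,f_v$ are assumed future directed, so $F<0$. The Gauss map is $\nu:M\to\mathbb S^3_1(1)$ with $\langle\nu,\nu\rangle=1$, $\langle\nu,f\rangle=\langle\nu,f_u\rangle=\langle\nu,f_v\rangle=0$ and $\{f,f_u,f_v,\nu\}$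 a positive basis of $\mathbb R^4_1$. Put $a=\langle f_{uu},\nu\rangle$, $b=\langle f_{uv},\nu\rangle$, $c=\langle f_{vv},\nu\rangle$. Minimal means zero mean curvature in $\mathbb S^3_1(1)$ (trace of the shape operator is zero). That $(M,\nu)$ has the same isotropic parameters means that $u,v$ are null coordinates for $\nu$, i.e. the metric induced by $\nu$ is $2\hat F\,du\,dv$ with $\hat F=\langle\nu_u,\nu_v\rangle$. $K(\cdot)$ is the Gauss curvature of the induced metric, and flat means zero Gauss curvature.
   Formalization: Minimality of ν and F²K(f)+acK(ν)=0 are stated only where the metric induced by ν is nondegenerate (ac≠0); where ac=0, K(ν) does not exist and F²K(f)=F²≠0. Flat means a nondegenerate metric on all of M with zero Gauss curvature. *)

theory Defs
  imports "HOL-Analysis.Analysis"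
begin

definition mink :: "real^4 \<Rightarrow> real^4 \<Rightarrow> real"
  where "mink p q = - (p$1 * q$1) + p$2 * q$2 + p$3 * q$3 + p$4 * q$4"

definition de_sitter :: "(real^4) set"
  where "de_sitter = {p. mink p p = 1}"

definition future_directed :: "real^4 \<Rightarrow> bool"
  where "future_directed p \<longleftrightarrow> mink p p \<le> 0 \<and> mink p (axis 1 1) < 0"

definition positive_basis :: "real^4 \<Rightarrow> real^4 \<Rightarrow> real^4 \<Rightarrow> real^4 \<Rightarrow> bool"
  where "positive_basis p q r s \<longleftrightarrow> det (vector [p, q, r, s] :: real^4^4) > 0"

text \<open>A parameter is \<open>w = u + iv\<close>; the index \<open>1\<close> stands for \<open>u\<close> and the index \<open>2\<close> for \<open>v\<close>.\<close>

definition pd :: "2 \<Rightarrow> (complex \<Rightarrow> 'a::real_normed_vector) \<Rightarrow> complex \<Rightarrow> 'a"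
  where "pd i X w = frechet_derivative X (at w) (if i = 1 then 1 else \<i>)"

text \<open>\<open>Ck_on k U X\<close> is meant for open \<open>U\<close>, where it says that \<open>X\<close> is of class \<open>C\<^sup>k\<close> on \<open>U\<close>.\<close>

fun Ck_on :: "nat \<Rightarrow> complex set \<Rightarrow> (complex \<Rightarrow> 'a::real_normed_vector) \<Rightarrow> bool"
  where
    "Ck_on 0 U X \<longleftrightarrow> continuous_on U X"
  | "Ck_on (Suc k) U X \<longleftrightarrow> (\<forall>w\<in>U. X differentiable (at w)) \<and> (\<forall>i. Ck_on k U (pd i X))"

definition smooth_on :: "complex set \<Rightarrow> (complex \<Rightarrow> 'a::real_normed_vector) \<Rightarrow> bool"
  where "smooth_on U X \<longleftrightarrow> (\<forall>k. Ck_on k U X)"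

definition induced_metric :: "(complex \<Rightarrow> real^4) \<Rightarrow> complex \<Rightarrow> real^2^2"
  where "induced_metric X w = (\<chi> i j. mink (pd i X w) (pd j X w))"

definition null_coordinates :: "complex set \<Rightarrow> (complex \<Rightarrow> real^4) \<Rightarrow> bool"
  where "null_coordinates M X \<longleftrightarrow>
    (\<forall>w\<in>M. mink (pd 1 X w) (pd 1 X w) = 0 \<and> mink (pd 2 X w) (pd 2 X w) = 0)"

definition isotropic_surface :: "complex set \<Rightarrow> (complex \<Rightarrow> real^4) \<Rightarrow> bool"
  where "isotropic_surface M X \<longleftrightarrow>
    smooth_on M X \<and> (\<exists>g. homeomorphism M (X ` M) X g) \<and> X ` M \<subseteq> de_sitter \<and>
    null_coordinates M X \<and>
    (\<forall>w\<in>M. pd 1 X w \<noteq> pd 2 X w \<and> independent {pd 1 X w, pd 2 X w} \<and>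
       mink (pd 1 X w) (pd 2 X w) \<noteq> 0 \<and>
       future_directed (pd 1 X w) \<and> future_directed (pd 2 X w))"

definition gauss_map :: "complex set \<Rightarrow> (complex \<Rightarrow> real^4) \<Rightarrow> (complex \<Rightarrow> real^4) \<Rightarrow> bool"
  where "gauss_map U X N \<longleftrightarrow>
    smooth_on U N \<and> N ` U \<subseteq> de_sitter \<and>
    (\<forall>w\<in>U. mink (N w) (X w) = 0 \<and> (\<forall>i. mink (N w) (pd i X w) = 0) \<and>
       positive_basis (X w) (pd 1 X w) (pd 2 X w) (N w))"

text \<open>The points where the induced metric is nondegenerate. Normal field, shape operator and
  Gauss curvature make sense only there.\<close>

definition regular_points :: "complex set \<Rightarrow> (complex \<Rightarrow> real^4) \<Rightarrow> complex set"
  where "regular_points M X = {w \<in> M. det (induced_metric X w) \<noteq> 0}"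

text \<open>\<open>A\<close> is the matrix of the shape operator \<open>S = - dN\<close> in the tangent basis \<open>X\<^sub>u, X\<^sub>v\<close>; its
  \<open>j\<close>-th column holds the coordinates of \<open>S X\<^sub>j = - N\<^sub>j\<close>. It is unique wherever \<open>X\<^sub>u, X\<^sub>v\<close> are
  independent.\<close>

definition is_shape_matrix ::
    "(complex \<Rightarrow> real^4) \<Rightarrow> (complex \<Rightarrow> real^4) \<Rightarrow> complex \<Rightarrow> real^2^2 \<Rightarrow> bool"
  where "is_shape_matrix X N w A \<longleftrightarrow>
    (\<forall>j. - pd j N w = (\<Sum>i\<in>UNIV. (A$i$j) *\<^sub>R pd i X w))"

text \<open>The existential quantifier over \<open>N\<close> asserts that the Gauss map exists on the regular points;
  it is unique there, being oriented.\<close>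

definition minimal_surface :: "complex set \<Rightarrow> (complex \<Rightarrow> real^4) \<Rightarrow> bool"
  where "minimal_surface M X \<longleftrightarrow>
    X ` M \<subseteq> de_sitter \<and>
    (\<exists>N. gauss_map (regular_points M X) X N \<and>
      (\<forall>w\<in>regular_points M X. \<exists>A. is_shape_matrix X N w A \<and> trace A = 0))"

text \<open>Christoffel symbol \<open>\<Gamma>\<^sup>k\<^sub>i\<^sub>j\<close> of the Levi-Civita connection of \<open>g\<close>.\<close>

definition christoffel :: "(complex \<Rightarrow> real^2^2) \<Rightarrow> 2 \<Rightarrow> 2 \<Rightarrow> 2 \<Rightarrow> complex \<Rightarrow> real"
  where "christoffel g k i j w =
    (\<Sum>l\<in>UNIV. (matrix_inv (g w))$k$l *
      (pd i (\<lambda>z. g z $ j $ l) w + pd j (\<lambda>z. g z $ i $ l) w - pd l (\<lambda>z. g z $ i $ j) w)) / 2"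

text \<open>Component \<open>l\<close> of \<open>R(\<partial>\<^sub>u,\<partial>\<^sub>v)\<partial>\<^sub>v = \<nabla>\<^sub>u\<nabla>\<^sub>v\<partial>\<^sub>v - \<nabla>\<^sub>v\<nabla>\<^sub>u\<partial>\<^sub>v\<close>.\<close>

definition riemann_uvv :: "(complex \<Rightarrow> real^2^2) \<Rightarrow> 2 \<Rightarrow> complex \<Rightarrow> real"
  where "riemann_uvv g l w =
    pd 1 (christoffel g l 2 2) w - pd 2 (christoffel g l 1 2) w +
    (\<Sum>m\<in>UNIV. christoffel g m 2 2 w * christoffel g l 1 m w
             - christoffel g m 1 2 w * christoffel g l 2 m w)"

text \<open>\<open>K = \<langle>R(\<partial>\<^sub>u,\<partial>\<^sub>v)\<partial>\<^sub>v, \<partial>\<^sub>u\<rangle> / det g\<close>, normalised so that the de Sitter plane of radius 1 has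
  \<open>K = 1\<close>. Meaningful where \<open>g\<close> is nondegenerate.\<close>

definition gauss_curvature :: "(complex \<Rightarrow> real^2^2) \<Rightarrow> complex \<Rightarrow> real"
  where "gauss_curvature g w = (\<Sum>l\<in>UNIV. g w $ 1 $ l * riemann_uvv g l w) / det (g w)"

abbreviation surface_curvature :: "(complex \<Rightarrow> real^4) \<Rightarrow> complex \<Rightarrow> real"
  where "surface_curvature X \<equiv> gauss_curvature (induced_metric X)"

text \<open>A flat surface has a Gauss curvature at each of its points, so its metric must be
  nondegenerate on all of \<open>M\<close>.\<close>

definition flat_surface :: "complex set \<Rightarrow> (complex \<Rightarrow> real^4) \<Rightarrow> bool"
  where "flat_surface M X \<longleftrightarrow>
    (\<forall>w\<in>M. det (induced_metric X w) \<noteq> 0 \<and> surface_curvature X w = 0)"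

end

theory Submission
  imports Defs
begin

text \<open>
  Everything is read off the frame \<open>f, f\<^sub>u, f\<^sub>v, \<nu>\<close>. Its Gram matrix is constant apart from the
  entry \<open>F = \<langle>f\<^sub>u, f\<^sub>v\<rangle>\<close>, so a vector is known once its four products with the frame are known, and
  for derivatives of the frame these products come from differentiating the Gram matrix.
  Minimality in null coordinates says \<open>b = \<langle>f\<^sub>u\<^sub>v, \<nu>\<rangle> = 0\<close>, and the structure equations collapse to
  \<open>f\<^sub>u\<^sub>v = - F f\<close>, \<open>f\<^sub>u\<^sub>u = (F\<^sub>u/F) f\<^sub>u + a \<nu>\<close>, \<open>f\<^sub>v\<^sub>v = (F\<^sub>v/F) f\<^sub>v + c \<nu>\<close>, \<open>\<nu>\<^sub>u = - (a/F) f\<^sub>v\<close> and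
  \<open>\<nu>\<^sub>v = - (c/F) f\<^sub>u\<close>. The last two show that \<open>\<nu>\<close> has null partial derivatives, with
  \<open>\<langle>\<nu>\<^sub>u, \<nu>\<^sub>v\<rangle> = ac/F\<close>. Hence \<open>\<nu>\<close> is regular exactly where \<open>ac\<close> does not vanish.

  At regular points the tangent plane of \<open>\<nu>\<close> is that of \<open>f\<close>, so its unit normals are \<open>f\<close> and \<open>- f\<close>;
  orientation selects \<open>sgn (ac) f\<close>, and the sign is locally constant. Since \<open>f\<^sub>u\<close> is a multiple of
  \<open>\<nu>\<^sub>v\<close> and \<open>f\<^sub>v\<close> a multiple of \<open>\<nu>\<^sub>u\<close>, the shape operator of \<open>\<nu>\<close> is off-diagonal: \<open>\<nu>\<close> is minimal.

  A metric \<open>2 G du dv\<close> has curvature \<open>- (G\<^sub>v/G)\<^sub>u / G\<close>. Commuting third derivatives of \<open>f\<close> gives the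
  Codazzi equations \<open>a\<^sub>v = c\<^sub>u = 0\<close> and the Gauss equation \<open>(F\<^sub>v/F)\<^sub>u = ac/F - F\<close>. For
  \<open>G = ac/F\<close> the Codazzi equations make the contributions of \<open>a\<close> and \<open>c\<close> to \<open>(G\<^sub>v/G)\<^sub>u\<close> vanish, so
  \<open>(G\<^sub>v/G)\<^sub>u = - (F\<^sub>v/F)\<^sub>u\<close>. Therefore \<open>K(f) = 1 - ac/F\<^sup>2\<close> and \<open>K(\<nu>) = 1 - F\<^sup>2/(ac)\<close>. The curvature
  relation is immediate from these formulas, and either surface is flat precisely when \<open>ac = F\<^sup>2\<close>
  throughout \<open>M\<close>; this equation already forces \<open>ac\<close> to be nonzero, so a flat \<open>f\<close> has a regular
  \<open>\<nu>\<close>.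
\<close>

section \<open>Partial derivatives and functions of class \<open>C\<^sup>k\<close>\<close>

abbreviation coord_dir :: "2 \<Rightarrow> complex"
  where "coord_dir i \<equiv> (if i = 1 then 1 else \<i>)"

lemma pd_eq_derivative:
  assumes "(X has_derivative D) (at w)"
  shows "pd i X w = D (coord_dir i)"
  using frechet_derivative_at[OF assms] by (simp add: pd_def)

lemma pd_const [simp]: "pd i (\<lambda>z. k) w = 0"
  by (rule trans[OF pd_eq_derivative[OF has_derivative_const]]) simp

text \<open>Agreement on a neighbourhood suffices even where no derivative exists: \<open>X\<close> and \<open>Y\<close> have the same
  candidates for a derivative, so the choice made by \<open>frechet_derivative\<close> is the same.\<close>

lemma pd_cong:
  assumes "open U" "w \<in> U" "\<And>z. z \<in> U \<Longrightarrow> X z = Y z"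
  shows "pd i X w = pd i Y w"
proof -
  have "(X has_derivative D) (at w) \<longleftrightarrow> (Y has_derivative D) (at w)" for D
    using has_derivative_transform_within_open[OF _ assms(1,2), of X D UNIV Y]
      has_derivative_transform_within_open[OF _ assms(1,2), of Y D UNIV X] assms(3) by auto
  then show ?thesis by (simp add: pd_def frechet_derivative_def)
qed

lemma pd_eq_0:
  assumes "open U" "w \<in> U" "\<And>z. z \<in> U \<Longrightarrow> X z = 0"
  shows "pd i X w = 0"
  using pd_cong[OF assms, where i = i] by simp

lemma differentiable_cong_open:
  assumes "open U" "w \<in> U" "\<And>z. z \<in> U \<Longrightarrow> X z = Y z" "X differentiable (at w)"
  shows "Y differentiable (at w)"
  using assms(4) has_derivative_transform_within_open[OF _ assms(1,2), of X _ UNIV Y] assms(3)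
  unfolding differentiable_def by auto

lemma pd_add:
  assumes "X differentiable (at w)" "Y differentiable (at w)"
  shows "pd i (\<lambda>z. X z + Y z) w = pd i X w + pd i Y w"
proof -
  obtain D E where D: "(X has_derivative D) (at w)" and E: "(Y has_derivative E) (at w)"
    using assms unfolding differentiable_def by blast
  show ?thesis
    by (simp add: pd_eq_derivative[OF has_derivative_add[OF D E]] pd_eq_derivative[OF D]
        pd_eq_derivative[OF E])
qed

lemma
  assumes mul: "bounded_bilinear mul"
    and "X differentiable (at w)" "Y differentiable (at w)"
  shows differentiable_bilinear: "(\<lambda>z. mul (X z) (Y z)) differentiable (at w)"
    and pd_bilinear: "pd i (\<lambda>z. mul (X z) (Y z)) w = mul (pd i X w) (Y w) + mul (X w) (pd i Y w)"
proof -
  obtain D E where D: "(X has_derivative D) (at w)" and E: "(Y has_derivative E) (at w)"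
    using assms unfolding differentiable_def by blast
  note prd = bounded_bilinear.FDERIV[OF mul D E]
  show "(\<lambda>z. mul (X z) (Y z)) differentiable (at w)"
    using prd unfolding differentiable_def by blast
  show "pd i (\<lambda>z. mul (X z) (Y z)) w = mul (pd i X w) (Y w) + mul (X w) (pd i Y w)"
    by (simp add: pd_eq_derivative[OF prd] pd_eq_derivative[OF D] pd_eq_derivative[OF E])
qed

lemma differentiable_divide_real:
  fixes X Y :: "complex \<Rightarrow> real"
  assumes "X differentiable (at w)" "Y differentiable (at w)" "Y w \<noteq> 0"
  shows "(\<lambda>z. X z / Y z) differentiable (at w)"
    and "pd i (\<lambda>z. X z / Y z) w = (pd i X w * Y w - X w * pd i Y w) / (Y w)\<^sup>2"
proof -
  obtain D E where D: "(X has_derivative D) (at w)" and E: "(Y has_derivative E) (at w)"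
    using assms unfolding differentiable_def by blast
  note quot = has_derivative_divide'[OF D E assms(3)]
  show "(\<lambda>z. X z / Y z) differentiable (at w)"
    using quot unfolding differentiable_def by blast
  show "pd i (\<lambda>z. X z / Y z) w = (pd i X w * Y w - X w * pd i Y w) / (Y w)\<^sup>2"
    by (simp add: pd_eq_derivative[OF quot] pd_eq_derivative[OF D] pd_eq_derivative[OF E]
        power2_eq_square)
qed

lemma pd_diff:
  assumes "X differentiable (at w)" "Y differentiable (at w)"
  shows "pd i (\<lambda>z. X z - Y z) w = pd i X w - pd i Y w"
proof -
  obtain D E where D: "(X has_derivative D) (at w)" and E: "(Y has_derivative E) (at w)"
    using assms unfolding differentiable_def by blast
  show ?thesis
    by (simp add: pd_eq_derivative[OF has_derivative_diff[OF D E]] pd_eq_derivative[OF D]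
        pd_eq_derivative[OF E])
qed

lemma Ck_on_cong:
  assumes "open U" "\<And>z. z \<in> U \<Longrightarrow> X z = Y z" "Ck_on k U X"
  shows "Ck_on k U Y"
  using assms(2,3)
proof (induction k arbitrary: X Y)
  case 0
  then show ?case by (simp cong: continuous_on_cong)
next
  case (Suc k)
  have "Ck_on k U (pd i Y)" for i
    by (rule Suc.IH[of "pd i X"])
      (use Suc.prems(2) pd_cong[OF assms(1) _ Suc.prems(1)] in simp_all)
  moreover have "Y differentiable (at z)" if "z \<in> U" for z
    by (rule differentiable_cong_open[OF assms(1) that Suc.prems(1)]) (use Suc.prems(2) that in auto)
  ultimately show ?case by simp
qed

lemma Ck_on_subset:
  assumes "Ck_on k U X" "V \<subseteq> U"
  shows "Ck_on k V X"
  using assms by (induction k arbitrary: X) (auto intro: continuous_on_subset)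

lemma Ck_on_continuous_on: "Ck_on k U X \<Longrightarrow> continuous_on U X"
  by (cases k) (simp_all add: continuous_at_imp_continuous_on differentiable_imp_continuous_within)

lemma Ck_on_SucD: "Ck_on (Suc k) U X \<Longrightarrow> Ck_on k U X"
proof (induction k arbitrary: X)
  case 0
  then show ?case using Ck_on_continuous_on[of "Suc 0"] by simp
next
  case (Suc k)
  then show ?case by (metis Ck_on.simps(2))
qed

lemma Ck_on_const: "Ck_on k U (\<lambda>z. b)"
proof (induction k arbitrary: b)
  case (Suc k)
  have "pd i (\<lambda>z. b) = (\<lambda>z. 0)" for i by auto
  then show ?case using Suc by simp
qed simp

lemma Ck_on_add:
  assumes "open U" "Ck_on k U X" "Ck_on k U Y"
  shows "Ck_on k U (\<lambda>z. X z + Y z)"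
  using assms(2,3)
proof (induction k arbitrary: X Y)
  case 0
  then show ?case by (simp add: continuous_on_add)
next
  case (Suc k)
  have "Ck_on k U (pd i (\<lambda>z. X z + Y z))" for i
    by (rule Ck_on_cong[OF assms(1) _ Suc.IH[of "pd i X" "pd i Y"]])
      (use Suc.prems in \<open>auto simp: pd_add\<close>)
  then show ?case using Suc.prems by (auto intro: differentiable_add)
qed

text \<open>Both \<open>mink\<close> and the Euclidean product are instances. In the induction the factors vary, because
  the Leibniz rule pairs each factor with the derivatives of the other.\<close>

lemma Ck_on_bilinear:
  assumes "open U" "bounded_bilinear mul" "Ck_on k U X" "Ck_on k U Y"
  shows "Ck_on k U (\<lambda>z. mul (X z) (Y z))"
  using assms(3,4)
proof (induction k arbitrary: X Y)
  case 0
  then show ?case by (simp add: bounded_bilinear.continuous_on[OF assms(2)])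
next
  case (Suc k)
  have "Ck_on k U (pd i (\<lambda>z. mul (X z) (Y z)))" for i
    by (rule Ck_on_cong[OF assms(1) _ Ck_on_add[OF assms(1) Suc.IH[of "pd i X" Y] Suc.IH[of X "pd i Y"]]])
      (use Suc.prems Ck_on_SucD[OF Suc.prems(1)] Ck_on_SucD[OF Suc.prems(2)]
        in \<open>auto simp: pd_bilinear[OF assms(2)]\<close>)
  then show ?case using Suc.prems by (auto intro: differentiable_bilinear[OF assms(2)])
qed

lemma smooth_on_bilinear:
  assumes "open U" "bounded_bilinear mul" "smooth_on U X" "smooth_on U Y"
  shows "smooth_on U (\<lambda>z. mul (X z) (Y z))"
  using assms Ck_on_bilinear unfolding smooth_on_def by blast

lemma smooth_on_pd: "smooth_on U X \<Longrightarrow> smooth_on U (pd i X)"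
  unfolding smooth_on_def by (metis Ck_on.simps(2))

lemma smooth_on_Ck_on: "smooth_on U X \<Longrightarrow> Ck_on k U X"
  by (simp add: smooth_on_def)

lemma smooth_on_differentiable: "smooth_on U X \<Longrightarrow> w \<in> U \<Longrightarrow> X differentiable (at w)"
  unfolding smooth_on_def by (metis Ck_on.simps(2))

text \<open>Used for the normal \<open>sgn (ac) f\<close> of \<open>\<nu>\<close>: the sign may differ between the components of the set of
  regular points, but its derivative vanishes.\<close>

lemma pd_locally_constant_scaleR:
  fixes s :: "complex \<Rightarrow> real"
  assumes "X differentiable (at w)" "eventually (\<lambda>z. s z = s w) (nhds w)"
  shows "(\<lambda>z. s z *\<^sub>R X z) differentiable (at w)"
    and "pd i (\<lambda>z. s z *\<^sub>R X z) w = s w *\<^sub>R pd i X w"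
proof -
  obtain V where V: "open V" "w \<in> V" "\<And>z. z \<in> V \<Longrightarrow> s z = s w"
    using assms(2) unfolding eventually_nhds by blast
  have eq: "s w *\<^sub>R X z = s z *\<^sub>R X z" if "z \<in> V" for z using V(3)[OF that] by simp
  have d: "(\<lambda>z. s w *\<^sub>R X z) differentiable (at w)"
    using differentiable_bilinear[OF bounded_bilinear_scaleR differentiable_const assms(1)] .
  show "(\<lambda>z. s z *\<^sub>R X z) differentiable (at w)"
    by (rule differentiable_cong_open[OF V(1,2) eq d])
  show "pd i (\<lambda>z. s z *\<^sub>R X z) w = s w *\<^sub>R pd i X w"
    using pd_cong[OF V(1,2) eq]
      pd_bilinear[OF bounded_bilinear_scaleR differentiable_const assms(1), of i "s w"]
    by simp
qed

lemma Ck_on_locally_constant_scaleR: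
  fixes s :: "complex \<Rightarrow> real"
  assumes "open U" "\<And>w. w \<in> U \<Longrightarrow> eventually (\<lambda>z. s z = s w) (nhds w)" "Ck_on k U X"
  shows "Ck_on k U (\<lambda>z. s z *\<^sub>R X z)"
  using assms(3)
proof (induction k arbitrary: X)
  case 0
  have "isCont s w" if "w \<in> U" for w
    by (rule iffD2[OF isCont_cong[OF assms(2)[OF that]]]) simp
  then have "continuous_on U s" by (simp add: continuous_at_imp_continuous_on)
  then show ?case using 0 by (simp add: continuous_on_scaleR)
next
  case (Suc k)
  have "Ck_on k U (pd i (\<lambda>z. s z *\<^sub>R X z))" for i
    by (rule Ck_on_cong[OF assms(1) _ Suc.IH[of "pd i X"]])
      (use Suc.prems in \<open>simp_all add: pd_locally_constant_scaleR(2) assms(2)\<close>)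
  then show ?case
    using Suc.prems by (simp add: pd_locally_constant_scaleR(1) assms(2))
qed

section \<open>Symmetry of second partial derivatives\<close>

text \<open>The classical proof of Schwarz' theorem: the mean value theorem, applied in direction \<open>i\<close> and then
  in direction \<open>j\<close>, turns the double difference of \<open>X\<close> over a small square into a second
  derivative at a point of the square. The double difference is symmetric in \<open>i\<close> and \<open>j\<close>; this
  transfers to the second derivatives in the limit.\<close>

lemma double_difference_mean_value:
  fixes X :: "complex \<Rightarrow> real"
  assumes h: "0 < h"
    and sub: "\<And>s t. 0 \<le> s \<Longrightarrow> s \<le> h \<Longrightarrow> 0 \<le> t \<Longrightarrow> t \<le> h \<Longrightarrow>
      w + s *\<^sub>R coord_dir i + t *\<^sub>R coord_dir j \<in> U"
    and C2: "Ck_on 2 U X"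
  obtains s t where "0 \<le> s" "s \<le> h" "0 \<le> t" "t \<le> h"
    and "X (w + h *\<^sub>R coord_dir i + h *\<^sub>R coord_dir j) - X (w + h *\<^sub>R coord_dir i)
        - X (w + h *\<^sub>R coord_dir j) + X w
      = h\<^sup>2 * pd j (pd i X) (w + s *\<^sub>R coord_dir i + t *\<^sub>R coord_dir j)"
proof -
  have line: "((\<lambda>r. Y (p + r *\<^sub>R coord_dir k)) has_real_derivative pd k Y (p + r *\<^sub>R coord_dir k)) (at r)"
    if "Y differentiable (at (p + r *\<^sub>R coord_dir k))" for Y :: "complex \<Rightarrow> real" and p r k
  proof -
    obtain D where D: "(Y has_derivative D) (at (p + r *\<^sub>R coord_dir k))"
      using \<open>Y differentiable (at (p + r *\<^sub>R coord_dir k))\<close> unfolding differentiable_def by blast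
    have "((\<lambda>r. p + r *\<^sub>R coord_dir k) has_derivative (\<lambda>r. r *\<^sub>R coord_dir k)) (at r)"
      by (auto intro!: derivative_eq_intros)
    from diff_chain_at[OF this D] have "((\<lambda>r. Y (p + r *\<^sub>R coord_dir k)) has_derivative
        (\<lambda>r. D (r *\<^sub>R coord_dir k))) (at r)" by (simp add: o_def)
    moreover have "D (r *\<^sub>R coord_dir k) = pd k Y (p + r' *\<^sub>R coord_dir k) * r"
      if "(Y has_derivative D) (at (p + r' *\<^sub>R coord_dir k))" for r r'
      using pd_eq_derivative[OF that, of k] linear_scale[OF has_derivative_linear[OF D], of r]
      by (simp add: mult.commute)
    ultimately show ?thesis
      using D by (simp only: has_field_derivative_def)
  qed
  have dX: "X differentiable (at z)" and dXi: "pd i X differentiable (at z)" if "z \<in> U" for z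
    using C2 that by (auto simp: numeral_2_eq_2)
  define \<phi> where "\<phi> s = X (w + h *\<^sub>R coord_dir j + s *\<^sub>R coord_dir i) - X (w + s *\<^sub>R coord_dir i)" for s
  have "\<exists>s. 0 < s \<and> s < h \<and> \<phi> h - \<phi> 0 = (h - 0) *
      (pd i X (w + h *\<^sub>R coord_dir j + s *\<^sub>R coord_dir i) - pd i X (w + s *\<^sub>R coord_dir i))"
    unfolding \<phi>_def
    using sub[of _ h] sub[of _ 0] h
    by (intro MVT2 DERIV_diff line dX) (auto simp: algebra_simps)
  then obtain s where s: "0 < s" "s < h" and eq1: "\<phi> h - \<phi> 0 = h *
      (pd i X (w + h *\<^sub>R coord_dir j + s *\<^sub>R coord_dir i) - pd i X (w + s *\<^sub>R coord_dir i))"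
    by auto
  have "\<exists>t. 0 < t \<and> t < h \<and> pd i X (w + s *\<^sub>R coord_dir i + h *\<^sub>R coord_dir j)
      - pd i X (w + s *\<^sub>R coord_dir i + 0 *\<^sub>R coord_dir j)
      = (h - 0) * pd j (pd i X) (w + s *\<^sub>R coord_dir i + t *\<^sub>R coord_dir j)"
    using sub[of s] s h by (intro MVT2 line dXi) auto
  then obtain t where t: "0 < t" "t < h" and eq2: "pd i X (w + s *\<^sub>R coord_dir i + h *\<^sub>R coord_dir j)
      - pd i X (w + s *\<^sub>R coord_dir i) = h * pd j (pd i X) (w + s *\<^sub>R coord_dir i + t *\<^sub>R coord_dir j)"
    by auto
  have "X (w + h *\<^sub>R coord_dir i + h *\<^sub>R coord_dir j) - X (w + h *\<^sub>R coord_dir i)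
        - X (w + h *\<^sub>R coord_dir j) + X w = \<phi> h - \<phi> 0"
    by (simp add: \<phi>_def add.assoc add.commute add.left_commute)
  also have "\<dots> = h\<^sup>2 * pd j (pd i X) (w + s *\<^sub>R coord_dir i + t *\<^sub>R coord_dir j)"
    using eq1 eq2 by (simp add: power2_eq_square add.assoc add.commute add.left_commute)
  finally show ?thesis using s t by (intro that[of s t]) auto
qed

lemma mixed_partials_commute_real:
  fixes X :: "complex \<Rightarrow> real"
  assumes U: "open U" "w \<in> U" and C2: "Ck_on 2 U X"
  shows "pd i (pd j X) w = pd j (pd i X) w"
proof (rule ccontr)
  assume ne: "pd i (pd j X) w \<noteq> pd j (pd i X) w"
  define e where "e = \<bar>pd i (pd j X) w - pd j (pd i X) w\<bar> / 2"
  have e: "0 < e" using ne by (simp add: e_def)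
  have cont: "isCont (pd k (pd l X)) w" for k l
    using C2 U by (simp add: numeral_2_eq_2 continuous_on_eq_continuous_at)
  have near_value: "eventually (\<lambda>z. dist (pd k (pd l X) z) (pd k (pd l X) w) < e) (nhds w)" for k l
    using cont[of k l] e unfolding continuous_at_eps_delta eventually_nhds_metric by blast
  have "eventually (\<lambda>z. z \<in> U \<and> dist (pd i (pd j X) z) (pd i (pd j X) w) < e \<and>
      dist (pd j (pd i X) z) (pd j (pd i X) w) < e) (nhds w)"
    by (intro eventually_conj eventually_nhds_in_open[OF U] near_value)
  then obtain d where d: "0 < d" and ball: "\<And>z. dist z w < d \<Longrightarrow> z \<in> U \<and>
      dist (pd i (pd j X) z) (pd i (pd j X) w) < e \<and> dist (pd j (pd i X) z) (pd j (pd i X) w) < e"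
    unfolding eventually_nhds_metric by blast
  \<comment> \<open>Points of the square have distance at most \<open>2 h < d\<close> from \<open>w\<close>.\<close>
  define h where "h = d / 3"
  have h: "0 < h" using d by (simp add: h_def)
  have near: "dist (w + s *\<^sub>R coord_dir k + t *\<^sub>R coord_dir l) w < d"
    if "0 \<le> s" "s \<le> h" "0 \<le> t" "t \<le> h" for s t k l
  proof -
    have "norm (s *\<^sub>R coord_dir k + t *\<^sub>R coord_dir l) \<le> s + t"
      using that by (intro norm_triangle_le) auto
    also have "\<dots> < d" using that d by (simp add: h_def)
    finally show ?thesis by (simp add: dist_norm add.assoc)
  qed
  let ?\<Delta> = "\<lambda>k l. X (w + h *\<^sub>R coord_dir k + h *\<^sub>R coord_dir l) - X (w + h *\<^sub>R coord_dir k)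
        - X (w + h *\<^sub>R coord_dir l) + X w"
  have sub: "w + s *\<^sub>R coord_dir k + t *\<^sub>R coord_dir l \<in> U"
    if "0 \<le> s" "s \<le> h" "0 \<le> t" "t \<le> h" for s t k l
    using near[OF that] ball by blast
  have mean: "\<exists>p. dist p w < d \<and> ?\<Delta> k l = h\<^sup>2 * pd l (pd k X) p" for k l
  proof -
    obtain s t where st: "0 \<le> s" "s \<le> h" "0 \<le> t" "t \<le> h"
      and eq: "?\<Delta> k l = h\<^sup>2 * pd l (pd k X) (w + s *\<^sub>R coord_dir k + t *\<^sub>R coord_dir l)"
      by (rule double_difference_mean_value[of h w k l U X, OF h sub C2])
    show ?thesis by (rule exI[where x = "w + s *\<^sub>R coord_dir k + t *\<^sub>R coord_dir l"], rule conjI[OF near[OF st] eq])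
  qed
  obtain p where p: "dist p w < d" "?\<Delta> i j = h\<^sup>2 * pd j (pd i X) p"
    using mean[of i j] by (elim exE conjE)
  obtain q where q: "dist q w < d" "?\<Delta> j i = h\<^sup>2 * pd i (pd j X) q"
    using mean[of j i] by (elim exE conjE)
  have "?\<Delta> i j = ?\<Delta> j i" by (simp add: add.assoc add.commute add.left_commute)
  then have "pd j (pd i X) p = pd i (pd j X) q" using p q h by simp
  then show False using ball[OF p(1)] ball[OF q(1)] unfolding e_def dist_real_def
    by (simp add: abs_if field_simps split: if_splits)
qed

lemma mixed_partials_commute:
  fixes X :: "complex \<Rightarrow> 'a::euclidean_space"
  assumes U: "open U" "w \<in> U" and C2: "Ck_on 2 U X"
  shows "pd i (pd j X) w = pd j (pd i X) w"
proof (rule euclidean_eqI)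
  fix b :: 'a
  have dX: "X differentiable (at z)" and dpX: "pd k X differentiable (at z)" if "z \<in> U" for z k
    using C2 that by (auto simp: numeral_2_eq_2)
  have comp: "pd k (\<lambda>z. Y z \<bullet> b) z = pd k Y z \<bullet> b" if "Y differentiable (at z)" for Y k z
    using pd_bilinear[OF bounded_bilinear_inner that differentiable_const] by simp
  have "pd k (pd l X) w \<bullet> b = pd k (pd l (\<lambda>z. X z \<bullet> b)) w" for k l
    using pd_cong[OF U, of "pd l (\<lambda>z. X z \<bullet> b)" "\<lambda>z. pd l X z \<bullet> b"] comp dX dpX U by simp
  moreover have "Ck_on 2 U (\<lambda>z. X z \<bullet> b)"
    by (rule Ck_on_bilinear[OF U(1) bounded_bilinear_inner C2 Ck_on_const])
  ultimately show "pd i (pd j X) w \<bullet> b = pd j (pd i X) w \<bullet> b"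
    using mixed_partials_commute_real[OF U] by simp
qed

section \<open>Null frames in Minkowski space\<close>

lemma bounded_bilinear_mink: "bounded_bilinear mink"
proof -
  have "bilinear mink"
    unfolding bilinear_def by (auto intro!: linearI simp: mink_def algebra_simps)
  then show ?thesis by (simp add: bilinear_conv_bounded_bilinear)
qed

lemmas mink_simps =
  bounded_bilinear.add_left[OF bounded_bilinear_mink]
  bounded_bilinear.add_right[OF bounded_bilinear_mink]
  bounded_bilinear.minus_left[OF bounded_bilinear_mink]
  bounded_bilinear.minus_right[OF bounded_bilinear_mink]
  bounded_bilinear.diff_left[OF bounded_bilinear_mink]
  bounded_bilinear.diff_right[OF bounded_bilinear_mink]
  bounded_bilinear.scaleR_left[OF bounded_bilinear_mink]
  bounded_bilinear.scaleR_right[OF bounded_bilinear_mink]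
  bounded_bilinear.zero_left[OF bounded_bilinear_mink]
  bounded_bilinear.zero_right[OF bounded_bilinear_mink]

lemma mink_commute: "mink p q = mink q p"
  by (simp add: mink_def mult.commute)

lemma vector_4_nth:
  fixes p :: "'a::zero"
  shows "(vector [p, q, r, s] :: 'a^4) $ 1 = p" "(vector [p, q, r, s] :: 'a^4) $ 2 = q"
    "(vector [p, q, r, s] :: 'a^4) $ 3 = r" "(vector [p, q, r, s] :: 'a^4) $ 4 = s"
  unfolding vector_def by simp_all

lemma det_scale_rows_4:
  fixes p q r s :: "real^4"
  shows "det (vector [\<alpha> *\<^sub>R p, \<beta> *\<^sub>R q, \<gamma> *\<^sub>R r, \<delta> *\<^sub>R s] :: real^4^4)
    = \<alpha> * \<beta> * \<gamma> * \<delta> * det (vector [p, q, r, s] :: real^4^4)"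
proof -
  let ?c = "vector [\<alpha>, \<beta>, \<gamma>, \<delta>] :: real^4" and ?A = "vector [p, q, r, s] :: real^4^4"
  have "(vector [\<alpha> *\<^sub>R p, \<beta> *\<^sub>R q, \<gamma> *\<^sub>R r, \<delta> *\<^sub>R s] :: real^4^4)
      = (\<chi> i. ?c $ i *s ?A $ i)"
    by (simp add: vec_eq_iff forall_4 vector_4_nth)
  moreover have "det (\<chi> i. ?c $ i *s ?A $ i) = prod (\<lambda>i. ?c $ i) UNIV * det (\<chi> i. ?A $ i)"
    by (rule det_rows_mul)
  moreover have "prod (\<lambda>i. ?c $ i) UNIV = \<alpha> * \<beta> * \<gamma> * \<delta>"
    unfolding UNIV_4 by (simp add: vector_4_nth)
  ultimately show ?thesis by (simp only: vec_lambda_eta)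
qed

text \<open>The reversal of four rows is a product of two transpositions, hence even. It relates the frame of
  \<open>\<nu>\<close>, which consists of multiples of \<open>\<nu>, f\<^sub>v, f\<^sub>u, f\<close>, to the frame \<open>f, f\<^sub>u, f\<^sub>v, \<nu>\<close> of \<open>f\<close>.\<close>

lemma det_reverse_rows_4:
  fixes p q r s :: "real^4"
  shows "det (vector [s, r, q, p] :: real^4^4) = det (vector [p, q, r, s] :: real^4^4)"
proof -
  let ?\<sigma> = "Transposition.transpose 1 4 \<circ> Transposition.transpose 2 3 :: 4 \<Rightarrow> 4"
  have perm: "?\<sigma> permutes UNIV"
    by (intro permutes_compose permutes_swap_id) auto
  have sgn: "sign ?\<sigma> = 1"
    by (subst sign_compose) (auto simp: permutation_swap_id sign_swap_id)
  have "(vector [s, r, q, p] :: real^4^4) = (\<chi> i. (vector [p, q, r, s] :: real^4^4) $ ?\<sigma> i)"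
    by (simp add: vec_eq_iff forall_4 vector_4_nth Transposition.transpose_def)
  then show ?thesis using det_permute_rows[OF perm, of "vector [p, q, r, s] :: real^4^4"] sgn by simp
qed

text \<open>A pseudo-orthonormal frame in which an orthonormal pair spanning the Lorentzian plane is replaced
  by two null vectors \<open>p\<close>, \<open>q\<close>. Only the scale \<open>mink p q\<close> is left free.\<close>

locale null_frame =
  fixes x p q n :: "real^4"
  assumes xx: "mink x x = 1" and nn: "mink n n = 1" and pp: "mink p p = 0" and qq: "mink q q = 0"
    and pq: "mink p q \<noteq> 0" and nx: "mink n x = 0" and xp: "mink x p = 0" and xq: "mink x q = 0"
    and np: "mink n p = 0" and nq: "mink n q = 0" and pos: "positive_basis x p q n"
begin

lemma orthogonal_to_frame_imp_0:
  assumes "mink y x = 0" "mink y p = 0" "mink y q = 0" "mink y n = 0"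
  shows "y = 0"
proof -
  \<comment> \<open>Apart from its sign in the first entry, \<open>?y\<close> is \<open>y\<close>; the sign turns \<open>mink\<close> into the Euclidean product of
     the rows of \<open>?A\<close> with \<open>?y\<close>.\<close>
  let ?A = "vector [x, p, q, n] :: real^4^4" and ?y = "vector [- (y$1), y$2, y$3, y$4] :: real^4"
  have "?A *v ?y = 0"
    using assms
    by (simp add: vec_eq_iff forall_4 matrix_vector_mult_def sum_4 vector_4_nth mink_def algebra_simps)
  moreover have "invertible ?A"
    using pos by (simp add: invertible_det_nz positive_basis_def)
  ultimately have "?y = 0"
    using invertible_left_inverse[of ?A] matrix_left_invertible_ker[of ?A] by blast
  then show ?thesis by (simp add: vec_eq_iff forall_4 vector_4_nth)
qed

text \<open>Since \<open>p\<close> and \<open>q\<close> are null, the coefficient along \<open>p\<close> is obtained by pairing with \<open>q\<close>, and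
  conversely.\<close>

lemma frame_expansion:
  "y = mink y x *\<^sub>R x + (mink y q / mink p q) *\<^sub>R p + (mink y p / mink p q) *\<^sub>R q + mink y n *\<^sub>R n"
  (is "y = ?e")
proof -
  have "y - ?e = 0"
    by (rule orthogonal_to_frame_imp_0)
      (use pq in \<open>auto simp: mink_simps xx nn pp qq nx xp xq np nq mink_commute[of x n]
        mink_commute[of p x] mink_commute[of q x] mink_commute[of p n] mink_commute[of q n]
        mink_commute[of q p]\<close>)
  then show ?thesis by simp
qed

text \<open>The frame expansion leaves \<open>m = t n\<close>. The length gives \<open>t\<^sup>2 = 1\<close>, and the orientation excludes
  \<open>t = - 1\<close>.\<close>

lemma oriented_normal_unique:
  assumes "mink m m = 1" "mink m x = 0" "mink m p = 0" "mink m q = 0" "positive_basis x p q m"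
  shows "m = n"
proof -
  define t where "t = mink m n"
  have m: "m = t *\<^sub>R n" using frame_expansion[of m] assms by (simp add: t_def)
  have "t\<^sup>2 = 1" using assms(1) nn by (simp add: m mink_simps power2_eq_square)
  moreover have "0 < t"
    using assms(5) pos det_scale_rows_4[of 1 x 1 p 1 q t n]
    by (simp add: positive_basis_def m zero_less_mult_iff)
  ultimately have "t = 1" using power2_eq_1_iff[of t] by auto
  then show ?thesis using m by simp
qed

end

section \<open>Gauss curvature of a metric in null coordinates\<close>

lemma induced_metric_null:
  assumes "mink (pd 1 X w) (pd 1 X w) = 0" "mink (pd 2 X w) (pd 2 X w) = 0"
  shows "induced_metric X w $ 1 $ 1 = 0" "induced_metric X w $ 2 $ 2 = 0"
    "induced_metric X w $ 1 $ 2 = mink (pd 1 X w) (pd 2 X w)"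
    "induced_metric X w $ 2 $ 1 = mink (pd 1 X w) (pd 2 X w)"
  using assms by (simp_all add: induced_metric_def mink_commute[of "pd 2 X w" "pd 1 X w"])

lemma det_induced_metric_null:
  assumes "mink (pd 1 X w) (pd 1 X w) = 0" "mink (pd 2 X w) (pd 2 X w) = 0"
  shows "det (induced_metric X w) = - (mink (pd 1 X w) (pd 2 X w))\<^sup>2"
  by (simp add: det_2 induced_metric_null[OF assms] power2_eq_square)

lemma matrix_inv_eqI:
  fixes A B :: "'a::field^'n^'n"
  assumes "A ** B = mat 1"
  shows "matrix_inv A = B"
proof -
  have BA: "B ** A = mat 1" using assms matrix_left_right_inverse by blast
  have "A ** matrix_inv A = mat 1 \<and> matrix_inv A ** A = mat 1"
    unfolding matrix_inv_def by (rule someI[of _ B]) (simp add: assms BA)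
  then have "B = (B ** A) ** matrix_inv A"
    by (simp flip: matrix_mul_assoc)
  then show ?thesis by (simp add: BA)
qed

text \<open>The inverse metric is off-diagonal with entries \<open>1/G\<close>, so among the Christoffel symbols that occur
  with \<open>l = 2\<close> only \<open>\<Gamma>\<^sup>2\<^sub>2\<^sub>2 = G\<^sub>v/G\<close> contributes. The component \<open>l = 1\<close> is multiplied by \<open>g\<^sub>1\<^sub>1 = 0\<close>.\<close>

lemma gauss_curvature_null_metric:
  fixes g :: "complex \<Rightarrow> real^2^2"
  assumes U: "open U" "w \<in> U"
    and g11: "\<And>z. z \<in> U \<Longrightarrow> g z $ 1 $ 1 = 0" and g22: "\<And>z. z \<in> U \<Longrightarrow> g z $ 2 $ 2 = 0"
    and g12: "\<And>z. z \<in> U \<Longrightarrow> g z $ 1 $ 2 = G z" and g21: "\<And>z. z \<in> U \<Longrightarrow> g z $ 2 $ 1 = G z"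
    and G: "\<And>z. z \<in> U \<Longrightarrow> G z \<noteq> 0"
  shows "gauss_curvature g w = - pd 1 (\<lambda>z. pd 2 G z / G z) w / G w"
proof -
  have inv: "matrix_inv (g z) $ 1 $ 1 = 0" "matrix_inv (g z) $ 2 $ 2 = 0"
    "matrix_inv (g z) $ 1 $ 2 = 1 / G z" "matrix_inv (g z) $ 2 $ 1 = 1 / G z" if "z \<in> U" for z
  proof -
    have "matrix_inv (g z) = vector [vector [0, 1 / G z], vector [1 / G z, 0]]"
      by (rule matrix_inv_eqI)
        (use that in \<open>simp add: vec_eq_iff forall_2 matrix_matrix_mult_def sum_2 g11 g22 g12 g21 G mat_def\<close>)
    then show "matrix_inv (g z) $ 1 $ 1 = 0" "matrix_inv (g z) $ 2 $ 2 = 0"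
      "matrix_inv (g z) $ 1 $ 2 = 1 / G z" "matrix_inv (g z) $ 2 $ 1 = 1 / G z"
      by simp_all
  qed
  have dg: "pd i (\<lambda>z. g z $ 1 $ 1) z = 0" "pd i (\<lambda>z. g z $ 2 $ 2) z = 0"
    "pd i (\<lambda>z. g z $ 1 $ 2) z = pd i G z" "pd i (\<lambda>z. g z $ 2 $ 1) z = pd i G z"
    if "z \<in> U" for i z
    using that g11 g22 g12 g21 by (auto intro!: pd_eq_0[OF U(1)] pd_cong[OF U(1)])
  have chr: "christoffel g 2 2 2 z = pd 2 G z / G z" "christoffel g 2 1 2 z = 0"
    "christoffel g 1 2 2 z = 0" "christoffel g 1 1 2 z = 0" if "z \<in> U" for z
    using that by (simp_all add: christoffel_def sum_2 inv dg)
  have "riemann_uvv g 2 w = pd 1 (\<lambda>z. pd 2 G z / G z) w"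
    using U pd_cong[OF U, of "christoffel g 2 2 2" "\<lambda>z. pd 2 G z / G z" 1]
      pd_eq_0[OF U, of "christoffel g 2 1 2" 2]
    by (simp add: riemann_uvv_def sum_2 chr)
  then show ?thesis
    using U(2) G by (simp add: gauss_curvature_def sum_2 det_2 g11 g22 g12 g21)
qed

section \<open>Isotropic surfaces with a Gauss map\<close>

locale oriented_isotropic_surface =
  fixes M :: "complex set" and f \<nu> :: "complex \<Rightarrow> real^4" and F :: "complex \<Rightarrow> real"
  assumes open_M: "open M" and iso: "isotropic_surface M f" and gauss: "gauss_map M f \<nu>"
    and F_eq: "F = (\<lambda>w. mink (pd 1 f w) (pd 2 f w))"
begin

lemma smooth_f: "smooth_on M f" and smooth_nu: "smooth_on M \<nu>"
  using iso gauss by (auto simp: isotropic_surface_def gauss_map_def)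

lemma smooth_mink: "smooth_on M X \<Longrightarrow> smooth_on M Y \<Longrightarrow> smooth_on M (\<lambda>z. mink (X z) (Y z))"
  by (rule smooth_on_bilinear[OF open_M bounded_bilinear_mink])

lemma smooth_F: "smooth_on M F"
  unfolding F_eq by (intro smooth_mink smooth_on_pd smooth_f)

lemma F_nonzero: "w \<in> M \<Longrightarrow> F w \<noteq> 0"
  using iso by (simp add: isotropic_surface_def F_eq)

lemma mink_f_f: "w \<in> M \<Longrightarrow> mink (f w) (f w) = 1"
  and mink_nu_nu: "w \<in> M \<Longrightarrow> mink (\<nu> w) (\<nu> w) = 1"
  and mink_nu_f: "w \<in> M \<Longrightarrow> mink (\<nu> w) (f w) = 0"
  and mink_nu_tangent: "w \<in> M \<Longrightarrow> mink (\<nu> w) (pd i f w) = 0"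
  using iso gauss by (auto simp: isotropic_surface_def gauss_map_def de_sitter_def image_subset_iff)

lemma mink_tangent_null: "w \<in> M \<Longrightarrow> mink (pd i f w) (pd i f w) = 0"
  using iso exhaust_2[of i] by (auto simp: isotropic_surface_def null_coordinates_def)

lemma F_off_diagonal: "i \<noteq> j \<Longrightarrow> mink (pd i f w) (pd j f w) = F w"
  using exhaust_2[of i] exhaust_2[of j] by (auto simp: F_eq mink_commute[of "pd 2 f w"])

lemma pd_mink:
  assumes "w \<in> M" "smooth_on M X" "smooth_on M Y"
  shows "pd i (\<lambda>z. mink (X z) (Y z)) w = mink (pd i X w) (Y w) + mink (X w) (pd i Y w)"
  using assms by (intro pd_bilinear[OF bounded_bilinear_mink] smooth_on_differentiable)

text \<open>Most of the structure equations come from here: nearly all products of frame vectors are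
  constant, and each of them gives a linear relation between the derivatives of its factors.\<close>

lemma differentiate_constant_product:
  assumes "w \<in> M" "smooth_on M X" "smooth_on M Y" "\<And>z. z \<in> M \<Longrightarrow> mink (X z) (Y z) = k"
  shows "mink (pd i X w) (Y w) + mink (X w) (pd i Y w) = 0"
  using pd_mink[OF assms(1-3), of i] pd_cong[OF open_M assms(1), of "\<lambda>z. mink (X z) (Y z)" "\<lambda>z. k" i] assms(4)
  by simp

lemma mink_f_tangent: "w \<in> M \<Longrightarrow> mink (f w) (pd i f w) = 0"
  using differentiate_constant_product[OF _ smooth_f smooth_f mink_f_f, of w i]
  by (simp add: mink_commute[of "pd i f w" "f w"])

lemma mink_nu_pd_nu: "w \<in> M \<Longrightarrow> mink (\<nu> w) (pd i \<nu> w) = 0"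
  using differentiate_constant_product[OF _ smooth_nu smooth_nu mink_nu_nu, of w i]
  by (simp add: mink_commute[of "pd i \<nu> w" "\<nu> w"])

lemma null_frame_at: "w \<in> M \<Longrightarrow> null_frame (f w) (pd 1 f w) (pd 2 f w) (\<nu> w)"
  using gauss F_nonzero[of w] F_off_diagonal[of 1 2 w]
  by unfold_locales (auto simp: mink_f_f mink_nu_nu mink_nu_f mink_nu_tangent mink_tangent_null
      mink_f_tangent gauss_map_def)

text \<open>The index pair \<open>i \<noteq> j\<close> treats \<open>u\<close> and \<open>v\<close> alike. Exchanging them reverses the orientation of the
  frame, but the expansion does not depend on the orientation.\<close>

lemma frame_expansion_at:
  assumes "w \<in> M" "i \<noteq> j"
  shows "y = mink y (f w) *\<^sub>R f w + (mink y (pd j f w) / F w) *\<^sub>R pd i f w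
    + (mink y (pd i f w) / F w) *\<^sub>R pd j f w + mink y (\<nu> w) *\<^sub>R \<nu> w"
  using null_frame.frame_expansion[OF null_frame_at[OF assms(1)], of y] assms(2)
    exhaust_2[of i] exhaust_2[of j] F_off_diagonal[of 1 2 w] by (auto simp: algebra_simps)

lemma commute_pd_f: "w \<in> M \<Longrightarrow> pd i (pd j f) w = pd j (pd i f) w"
  by (rule mixed_partials_commute[OF open_M _ smooth_on_Ck_on[OF smooth_f]])

lemma mink_pd_pd_null: "w \<in> M \<Longrightarrow> mink (pd i (pd j f) w) (pd j f w) = 0"
  using differentiate_constant_product[OF _ smooth_on_pd[OF smooth_f] smooth_on_pd[OF smooth_f]
      mink_tangent_null, of w i j]
  by (simp add: mink_commute[of "pd j f w"])

lemma mink_pd_nu_tangent: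
  "w \<in> M \<Longrightarrow> mink (pd j \<nu> w) (pd i f w) = - mink (pd j (pd i f) w) (\<nu> w)"
  using differentiate_constant_product[OF _ smooth_nu smooth_on_pd[OF smooth_f]
      mink_nu_tangent, of w j i]
  by (simp add: mink_commute[of "\<nu> w"])

lemma mink_pd_pd_f:
  "w \<in> M \<Longrightarrow> mink (pd i (pd j f) w) (f w) = - mink (pd i f w) (pd j f w)"
  using differentiate_constant_product[OF _ smooth_f smooth_on_pd[OF smooth_f]
      mink_f_tangent, of w i j]
  by (simp add: mink_commute[of "f w"])

lemma regular_points_f: "regular_points M f = M"
  using F_nonzero by (auto simp: regular_points_def F_eq det_induced_metric_null mink_tangent_null)

text \<open>A diagonal entry of the shape matrix is \<open>b/F\<close>, for both indices, so the trace is \<open>2 b/F\<close>. The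
  Gauss map provided by minimality has to be identified with \<open>\<nu>\<close> first.\<close>

lemma minimal_imp_mixed_form_0:
  assumes min: "minimal_surface M f" and w: "w \<in> M"
  shows "mink (pd 1 (pd 2 f) w) (\<nu> w) = 0"
proof -
  obtain N where N: "gauss_map M f N"
    and tr: "\<And>w. w \<in> M \<Longrightarrow> \<exists>A. is_shape_matrix f N w A \<and> trace A = 0"
    using min unfolding minimal_surface_def regular_points_f by blast
  have "N z = \<nu> z" if "z \<in> M" for z
    by (rule null_frame.oriented_normal_unique[OF null_frame_at[OF that]])
      (use N that in \<open>auto simp: gauss_map_def de_sitter_def image_subset_iff mink_commute\<close>)
  then have dN: "pd j N w = pd j \<nu> w" for j by (rule pd_cong[OF open_M w])
  obtain A where A: "is_shape_matrix f N w A" "trace A = 0" using tr[OF w] by blast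
  have col: "- pd j \<nu> w = (A$1$j) *\<^sub>R pd 1 f w + (A$2$j) *\<^sub>R pd 2 f w" for j
    using A(1) by (simp add: is_shape_matrix_def sum_2 dN)
  let ?b = "mink (pd 1 (pd 2 f) w) (\<nu> w)"
  have "mink (- pd 1 \<nu> w) (pd 2 f w) = A$1$1 * F w"
    unfolding col by (simp add: mink_simps mink_tangent_null w F_off_diagonal)
  then have "?b = A$1$1 * F w"
    by (simp add: mink_simps mink_pd_nu_tangent[OF w])
  moreover have "mink (- pd 2 \<nu> w) (pd 1 f w) = A$2$2 * F w"
    unfolding col by (simp add: mink_simps mink_tangent_null w F_off_diagonal)
  then have "?b = A$2$2 * F w"
    by (simp add: mink_simps mink_pd_nu_tangent[OF w] commute_pd_f[OF w, of 2 1])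
  moreover have "(A$1$1 + A$2$2) * F w = 0" using A(2) by (simp add: trace_def sum_2)
  then have "A$1$1 * F w + A$2$2 * F w = 0" by (simp add: distrib_right)
  ultimately show ?thesis by linarith
qed

end

section \<open>Structure equations of a minimal isotropic surface\<close>

locale minimal_isotropic_surface = oriented_isotropic_surface +
  assumes mixed_form_0: "w \<in> M \<Longrightarrow> mink (pd 1 (pd 2 f) w) (\<nu> w) = 0"
begin

text \<open>The coefficients of the Hopf differential: \<open>hopf 1 = a\<close> and \<open>hopf 2 = c\<close>.\<close>

definition hopf :: "2 \<Rightarrow> complex \<Rightarrow> real"
  where "hopf i w = mink (pd i (pd i f) w) (\<nu> w)"

lemma smooth_hopf: "smooth_on M (hopf i)"
  unfolding hopf_def[abs_def] by (intro smooth_mink smooth_on_pd smooth_f smooth_nu)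

text \<open>Minimality in its most useful form: the mixed derivative has no tangential part because the
  coordinates are null, and no part along \<open>\<nu>\<close> because \<open>b = 0\<close>. Only the part
  normal to the de Sitter space is left.\<close>

lemma pd_mixed_f:
  assumes "w \<in> M" "i \<noteq> j"
  shows "pd i (pd j f) w = - (F w *\<^sub>R f w)"
proof -
  have "mink (pd i (pd j f) w) (\<nu> w) = 0"
    using mixed_form_0[OF assms(1)] commute_pd_f[OF assms(1), of 1 2] assms(2)
      exhaust_2[of i] exhaust_2[of j] by auto
  moreover have "mink (pd i (pd j f) w) (pd i f w) = 0"
    using mink_pd_pd_null[OF assms(1), of j i] commute_pd_f[OF assms(1), of i j] by simp
  ultimately show ?thesis
    using frame_expansion_at[OF assms, of "pd i (pd j f) w"] mink_pd_pd_null[OF assms(1)]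
      mink_pd_pd_f[OF assms(1)] F_off_diagonal[OF assms(2)] by simp
qed

lemma pd_F:
  assumes "w \<in> M" "i \<noteq> j"
  shows "pd i F w = mink (pd i (pd i f) w) (pd j f w)"
proof -
  have "F = (\<lambda>z. mink (pd i f z) (pd j f z))" using F_off_diagonal[OF assms(2)] by auto
  then have "pd i F w = mink (pd i (pd i f) w) (pd j f w) + mink (pd i f w) (pd i (pd j f) w)"
    using pd_mink[OF assms(1) smooth_on_pd[OF smooth_f] smooth_on_pd[OF smooth_f]] by simp
  then show ?thesis
    using mink_f_tangent[OF assms(1)]
    by (simp add: pd_mixed_f[OF assms] mink_simps mink_commute[of "pd i f w" "f w"])
qed

lemma pd_pure_f:
  assumes "w \<in> M" "i \<noteq> j"
  shows "pd i (pd i f) w = (pd i F w / F w) *\<^sub>R pd i f w + hopf i w *\<^sub>R \<nu> w"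
  using frame_expansion_at[OF assms, of "pd i (pd i f) w"] pd_F[OF assms] mink_pd_pd_null[OF assms(1)]
    mink_pd_pd_f[OF assms(1)] mink_tangent_null[OF assms(1)] by (simp add: hopf_def)

lemma pd_nu:
  assumes "w \<in> M" "i \<noteq> j"
  shows "pd i \<nu> w = (- hopf i w / F w) *\<^sub>R pd j f w"
proof -
  have "mink (pd i \<nu> w) (pd i f w) = - hopf i w" "mink (pd i \<nu> w) (pd j f w) = 0"
    using mink_pd_nu_tangent[OF assms(1)] mink_nu_f[OF assms(1)]
    by (simp_all add: hopf_def pd_mixed_f[OF assms] mink_simps mink_commute[of "f w"])
  moreover have "mink (pd i \<nu> w) (f w) = 0"
    using differentiate_constant_product[OF assms(1) smooth_nu smooth_f mink_nu_f, of i]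
      mink_nu_tangent[OF assms(1)] by simp
  moreover have "mink (pd i \<nu> w) (\<nu> w) = 0"
    using mink_nu_pd_nu[OF assms(1)] by (simp add: mink_commute)
  ultimately show ?thesis using frame_expansion_at[OF assms, of "pd i \<nu> w"] by simp
qed

text \<open>Differentiating \<open>f\<^sub>u\<^sub>v = - F f\<close> once more and commuting derivatives; this single formula yields both
  integrability conditions below.\<close>

lemma pd_mixed_pure_f:
  assumes "w \<in> M" "i \<noteq> j"
  shows "pd j (pd i (pd i f)) w = - (pd i F w *\<^sub>R f w + F w *\<^sub>R pd i f w)"
proof -
  have "pd j (pd i (pd i f)) w = pd i (pd j (pd i f)) w"
    by (rule mixed_partials_commute[OF open_M assms(1) smooth_on_Ck_on[OF smooth_on_pd[OF smooth_f]]])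
  also have "\<dots> = pd i (\<lambda>z. (- F z) *\<^sub>R f z) w"
    using pd_mixed_f[OF _ assms(2)[symmetric]] by (intro pd_cong[OF open_M assms(1)]) simp
  also have "\<dots> = - (pd i F w *\<^sub>R f w + F w *\<^sub>R pd i f w)"
  proof -
    obtain D where D: "(F has_derivative D) (at w)"
      using smooth_on_differentiable[OF smooth_F assms(1)] unfolding differentiable_def by blast
    have "(\<lambda>z. - F z) differentiable (at w)" "pd i (\<lambda>z. - F z) w = - pd i F w"
      using has_derivative_minus[OF D] pd_eq_derivative[OF D] pd_eq_derivative[OF has_derivative_minus[OF D]]
      unfolding differentiable_def by auto
    then show ?thesis
      using pd_bilinear[OF bounded_bilinear_scaleR _ smooth_on_differentiable[OF smooth_f assms(1)],
        of "\<lambda>z. - F z" i] by simp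
  qed
  finally show ?thesis .
qed

text \<open>In \<open>a\<^sub>v = \<langle>f\<^sub>u\<^sub>u\<^sub>v, \<nu>\<rangle> + \<langle>f\<^sub>u\<^sub>u, \<nu>\<^sub>v\<rangle>\<close> the third derivative lies in the span of \<open>f\<close> and \<open>f\<^sub>u\<close>, and
  \<open>\<nu>\<^sub>v\<close> is a multiple of \<open>f\<^sub>u\<close>, to which \<open>f\<^sub>u\<^sub>u\<close> is orthogonal.\<close>

lemma codazzi:
  assumes "w \<in> M" "i \<noteq> j"
  shows "pd j (hopf i) w = 0"
proof -
  have "pd j (hopf i) w = mink (pd j (pd i (pd i f)) w) (\<nu> w) + mink (pd i (pd i f) w) (pd j \<nu> w)"
    unfolding hopf_def[abs_def]
    by (rule pd_mink[OF assms(1) smooth_on_pd[OF smooth_on_pd[OF smooth_f]] smooth_nu])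
  then show ?thesis
    using mink_nu_f[OF assms(1)] mink_nu_tangent[OF assms(1)] mink_pd_pd_null[OF assms(1)]
    by (simp add: pd_mixed_pure_f[OF assms] pd_nu[OF assms(1) assms(2)[symmetric]] mink_simps
        mink_commute[of "f w"] mink_commute[of "pd i f w"])
qed

text \<open>With \<open>F\<^sub>v = \<langle>f\<^sub>v\<^sub>v, f\<^sub>u\<rangle>\<close>, the derivative \<open>F\<^sub>u\<^sub>v\<close> is \<open>\<langle>f\<^sub>v\<^sub>v\<^sub>u, f\<^sub>u\<rangle> + \<langle>f\<^sub>v\<^sub>v, f\<^sub>u\<^sub>u\<rangle>\<close>. The first term is
  \<open>- F\<^sup>2\<close>, where the curvature of the ambient space enters; the second is \<open>F\<^sub>u F\<^sub>v/F + ac\<close>.\<close>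

lemma gauss_equation:
  assumes w: "w \<in> M"
  shows "pd 1 (\<lambda>z. pd 2 F z / F z) w = hopf 1 w * hopf 2 w / F w - F w"
proof -
  have "pd 1 (pd 2 F) w = pd 1 (\<lambda>z. mink (pd 2 (pd 2 f) z) (pd 1 f z)) w"
    using pd_F by (intro pd_cong[OF open_M w]) simp
  also have "\<dots> = mink (pd 1 (pd 2 (pd 2 f)) w) (pd 1 f w) + mink (pd 2 (pd 2 f) w) (pd 1 (pd 1 f) w)"
    by (intro pd_mink[OF w] smooth_on_pd smooth_f)
  also have "mink (pd 1 (pd 2 (pd 2 f)) w) (pd 1 f w) = - (F w)\<^sup>2"
    using mink_f_tangent[OF w] F_off_diagonal[of 2 1 w]
    by (simp add: pd_mixed_pure_f[OF w, of 2 1] mink_simps power2_eq_square)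
  also have "mink (pd 2 (pd 2 f) w) (pd 1 (pd 1 f) w) = pd 1 F w * pd 2 F w / F w + hopf 1 w * hopf 2 w"
    using F_off_diagonal[of 2 1 w] mink_nu_tangent[OF w] mink_nu_nu[OF w] F_nonzero[OF w]
    by (simp add: pd_pure_f[OF w, of 1 2] pd_pure_f[OF w, of 2 1] mink_simps mink_commute[of "pd 2 f w" "\<nu> w"])
  finally have FF: "pd 1 (pd 2 F) w = - (F w)\<^sup>2 + (pd 1 F w * pd 2 F w / F w + hopf 1 w * hopf 2 w)" .
  have "pd 1 (\<lambda>z. pd 2 F z / F z) w = (pd 1 (pd 2 F) w * F w - pd 2 F w * pd 1 F w) / (F w)\<^sup>2"
    by (intro differentiable_divide_real(2) smooth_on_differentiable[OF _ w] smooth_on_pd smooth_F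
        F_nonzero w)
  also have "\<dots> = hopf 1 w * hopf 2 w / F w - F w"
    using F_nonzero[OF w] by (simp add: FF field_simps power2_eq_square)
  finally show ?thesis .
qed

lemma surface_curvature_f:
  assumes w: "w \<in> M"
  shows "surface_curvature f w = 1 - hopf 1 w * hopf 2 w / (F w)\<^sup>2"
proof -
  have "surface_curvature f w = - pd 1 (\<lambda>z. pd 2 F z / F z) w / F w"
    by (rule gauss_curvature_null_metric[OF open_M w])
      (simp_all add: induced_metric_null mink_tangent_null F_nonzero F_off_diagonal)
  then show ?thesis
    using F_nonzero[OF w] by (simp add: gauss_equation[OF w] field_simps power2_eq_square)
qed

section \<open>The Gauss map as a surface\<close>

lemma mink_pd_nu_null:
  assumes "w \<in> M"
  shows "mink (pd i \<nu> w) (pd i \<nu> w) = 0"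
proof -
  obtain j where "i \<noteq> j" by (metis zero_neq_one)
  then show ?thesis by (simp add: pd_nu[OF assms] mink_simps mink_tangent_null[OF assms])
qed

lemma null_coordinates_nu: "null_coordinates M \<nu>"
  by (simp add: null_coordinates_def mink_pd_nu_null)

lemma mink_pd_nu:
  assumes "w \<in> M"
  shows "mink (pd 1 \<nu> w) (pd 2 \<nu> w) = hopf 1 w * hopf 2 w / F w"
  using F_nonzero[OF assms] F_off_diagonal[of 2 1 w]
  by (simp add: pd_nu[OF assms, of 1 2] pd_nu[OF assms, of 2 1] mink_simps)

lemma regular_points_nu: "regular_points M \<nu> = {w \<in> M. hopf 1 w * hopf 2 w \<noteq> 0}"
  using F_nonzero
  by (auto simp: regular_points_def det_induced_metric_null mink_pd_nu_null mink_pd_nu)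

lemma continuous_on_hopf_product: "continuous_on M (\<lambda>w. hopf 1 w * hopf 2 w)"
  by (intro continuous_on_mult Ck_on_continuous_on[where k = 0] smooth_on_Ck_on smooth_hopf)

lemma open_regular_points_nu: "open (regular_points M \<nu>)"
proof -
  have "regular_points M \<nu> = M \<inter> (\<lambda>w. hopf 1 w * hopf 2 w) -` (- {0})"
    by (auto simp: regular_points_nu)
  then show ?thesis
    using continuous_open_preimage[OF continuous_on_hopf_product open_M open_Compl[OF closed_singleton]]
    by simp
qed

text \<open>Because \<open>a\<^sub>v = c\<^sub>u = 0\<close>, passing from \<open>F\<close> to \<open>ac/F\<close> changes \<open>(F\<^sub>v/F)\<^sub>u\<close> only by its sign, so the
  Gauss equation for \<open>f\<close> also computes the curvature of \<open>\<nu>\<close>.\<close>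

lemma surface_curvature_nu:
  assumes w: "w \<in> regular_points M \<nu>"
  shows "surface_curvature \<nu> w = 1 - (F w)\<^sup>2 / (hopf 1 w * hopf 2 w)"
proof -
  let ?U = "regular_points M \<nu>" and ?G = "\<lambda>z. hopf 1 z * hopf 2 z / F z"
  note U = open_regular_points_nu w
  have M: "z \<in> M" and nz: "hopf 1 z \<noteq> 0" "hopf 2 z \<noteq> 0" if "z \<in> ?U" for z
    using that by (auto simp: regular_points_nu)
  have diff: "hopf k differentiable (at z)" "F differentiable (at z)"
    "pd k (hopf l) differentiable (at z)" "pd k F differentiable (at z)" if "z \<in> M" for k l z
    by (intro smooth_on_differentiable[OF _ that] smooth_on_pd smooth_F smooth_hopf)+
  have "surface_curvature \<nu> w = - pd 1 (\<lambda>z. pd 2 ?G z / ?G z) w / ?G w"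
    by (rule gauss_curvature_null_metric[OF U])
      (simp_all add: M nz induced_metric_null mink_pd_nu_null mink_pd_nu F_nonzero)
  \<comment> \<open>The logarithmic derivative of \<open>ac/F\<close>; the term of \<open>a\<close> is absent by the Codazzi equation \<open>a\<^sub>v = 0\<close>.\<close>
  also have "pd 1 (\<lambda>z. pd 2 ?G z / ?G z) w
      = pd 1 (\<lambda>z. pd 2 (hopf 2) z / hopf 2 z - pd 2 F z / F z) w"
  proof (rule pd_cong[OF U])
    fix z assume z: "z \<in> ?U"
    have "pd 2 ?G z = (pd 2 (\<lambda>z. hopf 1 z * hopf 2 z) z * F z - (hopf 1 z * hopf 2 z) * pd 2 F z) / (F z)\<^sup>2"
      by (intro differentiable_divide_real(2) differentiable_bilinear[OF bounded_bilinear_mult]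
          diff F_nonzero M z)
    also have "pd 2 (\<lambda>z. hopf 1 z * hopf 2 z) z = hopf 1 z * pd 2 (hopf 2) z"
      using pd_bilinear[OF bounded_bilinear_mult diff(1) diff(1), OF M[OF z] M[OF z], of 2 1 2]
        codazzi[OF M[OF z], of 1 2] by simp
    finally show "pd 2 ?G z / ?G z = pd 2 (hopf 2) z / hopf 2 z - pd 2 F z / F z"
      using F_nonzero[OF M[OF z]] nz[OF z] by (simp add: field_simps power2_eq_square)
  qed
  also have "\<dots> = pd 1 (\<lambda>z. pd 2 (hopf 2) z / hopf 2 z) w - pd 1 (\<lambda>z. pd 2 F z / F z) w"
    by (intro pd_diff differentiable_divide_real(1) diff F_nonzero M[OF w] nz[OF w])
  also have "pd 1 (\<lambda>z. pd 2 (hopf 2) z / hopf 2 z) w = 0"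
  proof -
    have "pd 1 (pd 2 (hopf 2)) w = pd 2 (pd 1 (hopf 2)) w"
      by (rule mixed_partials_commute[OF open_M M[OF w] smooth_on_Ck_on[OF smooth_hopf]])
    also have "\<dots> = 0"
      by (rule pd_eq_0[OF open_M M[OF w]]) (simp add: codazzi)
    finally show ?thesis
      using codazzi[OF M[OF w], of 2 1]
      by (subst differentiable_divide_real(2)) (simp_all add: diff M[OF w] nz[OF w])
  qed
  also have "- (0 - pd 1 (\<lambda>z. pd 2 F z / F z) w) / ?G w = 1 - (F w)\<^sup>2 / (hopf 1 w * hopf 2 w)"
    unfolding gauss_equation[OF M[OF w]]
    using F_nonzero[OF M[OF w]] nz[OF w] by (simp add: field_simps power2_eq_square)
  finally show ?thesis .
qed

text \<open>The oriented normal is \<open>sgn (ac) f\<close>: the frame of \<open>\<nu>\<close> is the reversed frame of \<open>f\<close> with its rows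
  scaled by \<open>1\<close>, \<open>- a/F\<close>, \<open>- c/F\<close> and the sign, so its determinant is \<open>\<bar>ac\<bar>/F\<^sup>2\<close> times that of the
  frame of \<open>f\<close>.\<close>

lemma minimal_surface_nu: "minimal_surface M \<nu>"
proof -
  let ?U = "regular_points M \<nu>" and ?s = "\<lambda>z. sgn (hopf 1 z * hopf 2 z)"
  define N where "N z = ?s z *\<^sub>R f z" for z
  have M: "z \<in> M" and nz: "hopf 1 z \<noteq> 0" "hopf 2 z \<noteq> 0" if "z \<in> ?U" for z
    using that by (auto simp: regular_points_nu)
  have loc: "eventually (\<lambda>z. ?s z = ?s w) (nhds w)" if w: "w \<in> ?U" for w
  proof -
    let ?h = "\<lambda>z. hopf 1 z * hopf 2 z"
    have side: "eventually (\<lambda>z. z \<in> M \<inter> ?h -` S) (nhds w)" if "open S" "?h w \<in> S" for S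
      using eventually_nhds_in_open[OF continuous_open_preimage[OF continuous_on_hopf_product open_M
            that(1)], of w] that(2) M[OF w] by simp
    show ?thesis
    proof (cases "0 < ?h w")
      case True
      with side[of "{0<..}"] show ?thesis by (auto elim: eventually_mono)
    next
      case False
      moreover have "?h w \<noteq> 0" using nz[OF w] by simp
      ultimately have "?h w < 0" by linarith
      with side[of "{..<0}"] show ?thesis by (auto elim: eventually_mono)
    qed
  qed
  have dN: "pd i N w = ?s w *\<^sub>R pd i f w" if "w \<in> ?U" for i w
    unfolding N_def[abs_def]
    by (rule pd_locally_constant_scaleR(2)[OF smooth_on_differentiable[OF smooth_f M[OF that]] loc[OF that]])
  have "smooth_on ?U N"
    unfolding smooth_on_def N_def[abs_def]
    by (intro allI Ck_on_locally_constant_scaleR open_regular_points_nu loc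
        Ck_on_subset[OF smooth_on_Ck_on[OF smooth_f]]) (use M in auto)
  moreover have "N ` ?U \<subseteq> de_sitter"
  proof -
    have "mink (N w) (N w) = 1" if "w \<in> ?U" for w
      using nz[OF that] mink_f_f[OF M[OF that]] by (simp add: N_def mink_simps sgn_if)
    then show ?thesis by (auto simp: de_sitter_def)
  qed
  moreover have "mink (N w) (\<nu> w) = 0" "mink (N w) (pd i \<nu> w) = 0"
    "positive_basis (\<nu> w) (pd 1 \<nu> w) (pd 2 \<nu> w) (N w)" if w: "w \<in> ?U" for w i
  proof -
    show "mink (N w) (\<nu> w) = 0"
      using mink_nu_f[OF M[OF w]] by (simp add: N_def mink_simps mink_commute[of "f w"])
    show "mink (N w) (pd i \<nu> w) = 0"
    proof -
      obtain j where "i \<noteq> j" by (metis zero_neq_one)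
      then show ?thesis
        using mink_f_tangent[OF M[OF w]] by (simp add: N_def mink_simps pd_nu[OF M[OF w]])
    qed
    have "0 < hopf 1 w * hopf 2 w * ?s w"
      unfolding abs_sgn[symmetric] using nz[OF w] by simp
    then have "0 < 1 * (- hopf 1 w / F w) * (- hopf 2 w / F w) * ?s w"
      using F_nonzero[OF M[OF w]] by (simp add: zero_less_divide_iff flip: power2_eq_square)
    moreover have "0 < det (vector [\<nu> w, pd 2 f w, pd 1 f w, f w] :: real^4^4)"
      using null_frame.pos[OF null_frame_at[OF M[OF w]]]
      by (simp add: positive_basis_def det_reverse_rows_4)
    ultimately have "0 < det (vector [1 *\<^sub>R \<nu> w, (- hopf 1 w / F w) *\<^sub>R pd 2 f w,
        (- hopf 2 w / F w) *\<^sub>R pd 1 f w, ?s w *\<^sub>R f w] :: real^4^4)"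
      unfolding det_scale_rows_4 by (rule mult_pos_pos)
    moreover have "pd 1 \<nu> w = (- hopf 1 w / F w) *\<^sub>R pd 2 f w" "pd 2 \<nu> w = (- hopf 2 w / F w) *\<^sub>R pd 1 f w"
      by (rule pd_nu[OF M[OF w]], simp)+
    ultimately show "positive_basis (\<nu> w) (pd 1 \<nu> w) (pd 2 \<nu> w) (N w)"
      by (simp only: positive_basis_def N_def scaleR_one)
  qed
  ultimately have "gauss_map ?U \<nu> N" by (simp add: gauss_map_def)
  moreover have "\<exists>A. is_shape_matrix \<nu> N w A \<and> trace A = 0" if w: "w \<in> ?U" for w
  proof (intro exI conjI)
    \<comment> \<open>Solving \<open>\<nu>\<^sub>u = - (a/F) f\<^sub>v\<close> and \<open>\<nu>\<^sub>v = - (c/F) f\<^sub>u\<close> for \<open>f\<^sub>v\<close> and \<open>f\<^sub>u\<close> gives the entries.\<close>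
    let ?A = "vector [vector [0, ?s w * F w / hopf 1 w], vector [?s w * F w / hopf 2 w, 0]] :: real^2^2"
    show "is_shape_matrix \<nu> N w ?A"
      using nz[OF w] F_nonzero[OF M[OF w]]
      by (simp add: is_shape_matrix_def forall_2 sum_2 dN[OF w] pd_nu[OF M[OF w], of 1 2]
          pd_nu[OF M[OF w], of 2 1])
    show "trace ?A = 0" by (simp add: trace_def sum_2)
  qed
  moreover have "\<nu> ` M \<subseteq> de_sitter" using gauss by (simp add: gauss_map_def)
  ultimately show ?thesis unfolding minimal_surface_def by blast
qed

lemma curvature_relation:
  assumes "w \<in> regular_points M \<nu>"
  shows "(F w)\<^sup>2 * surface_curvature f w + hopf 1 w * hopf 2 w * surface_curvature \<nu> w = 0"
  using assms F_nonzero[of w]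
  by (simp add: surface_curvature_f surface_curvature_nu regular_points_nu field_simps)

lemma flat_f_iff: "flat_surface M f \<longleftrightarrow> (\<forall>w\<in>M. hopf 1 w * hopf 2 w = (F w)\<^sup>2)"
proof -
  have "det (induced_metric f w) \<noteq> 0" if "w \<in> M" for w
    using that regular_points_f by (auto simp: regular_points_def)
  then show ?thesis
    using F_nonzero by (auto simp: flat_surface_def surface_curvature_f field_simps)
qed

text \<open>The condition includes the regularity of \<open>\<nu>\<close>, since \<open>F\<close> does not vanish.\<close>

lemma flat_nu_iff: "flat_surface M \<nu> \<longleftrightarrow> (\<forall>w\<in>M. hopf 1 w * hopf 2 w = (F w)\<^sup>2)"
proof -
  have "det (induced_metric \<nu> w) \<noteq> 0 \<and> surface_curvature \<nu> w = 0 \<longleftrightarrow> hopf 1 w * hopf 2 w = (F w)\<^sup>2"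
    if w: "w \<in> M" for w
  proof (cases "hopf 1 w * hopf 2 w = 0")
    case True
    then have "det (induced_metric \<nu> w) = 0" using w regular_points_nu by (auto simp: regular_points_def)
    moreover have "hopf 1 w * hopf 2 w \<noteq> (F w)\<^sup>2" using F_nonzero[OF w] by (simp only: True) simp
    ultimately show ?thesis by blast
  next
    case False
    then have reg: "w \<in> regular_points M \<nu>" using w by (auto simp: regular_points_nu)
    then have "det (induced_metric \<nu> w) \<noteq> 0" by (simp add: regular_points_def)
    then show ?thesis using False by (auto simp: surface_curvature_nu[OF reg] field_simps)
  qed
  then show ?thesis by (simp add: flat_surface_def)
qed

end

section \<open>The dual minimal surface\<close>

theorem theorem3p4:
  fixes M :: "complex set" and f \<nu> :: "complex \<Rightarrow> real^4" and F a c :: "complex \<Rightarrow> real"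
  assumes "open M" and "connected M" and "simply_connected M"
    and "isotropic_surface M f"
    and "gauss_map M f \<nu>"
    and "\<not> \<nu> constant_on M"
    and F_eq: "F = (\<lambda>w. mink (pd 1 f w) (pd 2 f w))"
    and a_eq: "a = (\<lambda>w. mink (pd 1 (pd 1 f) w) (\<nu> w))"
    and c_eq: "c = (\<lambda>w. mink (pd 2 (pd 2 f) w) (\<nu> w))"
    and "minimal_surface M f"
  shows "null_coordinates M \<nu> \<and> minimal_surface M \<nu> \<and>
    (\<forall>w\<in>M. pd 1 \<nu> w = (- a w / F w) *\<^sub>R pd 2 f w \<and>
            pd 2 \<nu> w = (- c w / F w) *\<^sub>R pd 1 f w) \<and>
    (\<forall>w\<in>regular_points M \<nu>.
      (F w)\<^sup>2 * surface_curvature f w + a w * c w * surface_curvature \<nu> w = 0) \<and>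
    (flat_surface M f \<longleftrightarrow> flat_surface M \<nu>)"
proof -
  interpret oriented_isotropic_surface M f \<nu> F
    by unfold_locales (use assms in auto)
  interpret minimal_isotropic_surface M f \<nu> F
    by unfold_locales (rule minimal_imp_mixed_form_0[OF \<open>minimal_surface M f\<close>])
  have a: "a = hopf 1" and c: "c = hopf 2"
    by (auto simp: a_eq c_eq hopf_def)
  show ?thesis
    unfolding a c
    using null_coordinates_nu minimal_surface_nu pd_nu[of _ 1 2] pd_nu[of _ 2 1]
      curvature_relation flat_f_iff flat_nu_iff by simp
qed

end
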